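(* For $n\ge 1$ let $a_n = |S_n^2(132,231,312)|$. Then $a_1=1$ and $a_{n+1} = a_n + 3$ for all $n\ge 1$.
   Context: A $3$-permutation of size $n$ is an ordered pair $(\sigma,\sigma')$ of permutations of $[n]=\{1,\dots,n\}$. A (classical) permutation $\tau\in S_n$ contains a pattern $\pi\in S_k$ if there are indices $c_1<\dots<c_k$ such that $\tau(c_1)\cdots\tau(c_k)$ is order-isomorphic to $\pi$, and avoids $\pi$ otherwise. A $3$-permutation $(\sigma,\sigma')$ avoids a pattern $\pi\in S_k$ if each of the three permutations $\sigma$, $\sigma'$, and $\sigma'\circ\sigma^{-1}$ (where $(\sigma'\circ\sigma^{-1})(i)=\sigma'(\sigma^{-1}(i))$) avoids $\pi$. $S_n^2(\pi_1,\dots,\pi_m)$ denotes the set of $3$-permutations of size $n$ avoiding each of $\pi_1,\dots,\pi_m$. Patterns are written in one-line notation. *)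

theory Defs
  imports "HOL-Combinatorics.Permutations"
begin

definition order_isomorphic :: "nat list \<Rightarrow> nat list \<Rightarrow> bool" where
  "order_isomorphic xs ys \<longleftrightarrow>
     length xs = length ys \<and>
     (\<forall>i < length xs. \<forall>j < length xs. xs ! i < xs ! j \<longleftrightarrow> ys ! i < ys ! j)"

(* A permutation of [n] is a function t with "t permutes {1..n}"; a pattern in S_k is given
   by its one-line notation, a list of length k.  The list cs is c_1 < ... < c_k. *)
definition contains_pattern :: "nat \<Rightarrow> (nat \<Rightarrow> nat) \<Rightarrow> nat list \<Rightarrow> bool" where
  "contains_pattern n t p \<longleftrightarrow>
     (\<exists>cs. sorted_wrt (<) cs \<and> set cs \<subseteq> {1..n} \<and> order_isomorphic (map t cs) p)"

definition avoids_pattern :: "nat \<Rightarrow> (nat \<Rightarrow> nat) \<Rightarrow> nat list \<Rightarrow> bool" where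
  "avoids_pattern n t p \<longleftrightarrow> \<not> contains_pattern n t p"

definition three_perms :: "nat \<Rightarrow> ((nat \<Rightarrow> nat) \<times> (nat \<Rightarrow> nat)) set" where
  "three_perms n = {(s, s'). s permutes {1..n} \<and> s' permutes {1..n}}"

definition three_perm_avoids ::
    "nat \<Rightarrow> (nat \<Rightarrow> nat) \<times> (nat \<Rightarrow> nat) \<Rightarrow> nat list \<Rightarrow> bool" where
  "three_perm_avoids n ss p \<longleftrightarrow>
     (case ss of (s, s') \<Rightarrow>
        avoids_pattern n s p \<and> avoids_pattern n s' p \<and> avoids_pattern n (s' \<circ> inv s) p)"

(* The set S_n^2(p_1,...,p_m), with P = {p_1,...,p_m}. *)
definition avoiding_three_perms ::
    "nat \<Rightarrow> nat list set \<Rightarrow> ((nat \<Rightarrow> nat) \<times> (nat \<Rightarrow> nat)) set" where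
  "avoiding_three_perms n P = {ss \<in> three_perms n. \<forall>p \<in> P. three_perm_avoids n ss p}"

end

theory Submission
  imports Defs
begin

text \<open>A permutation avoiding 132 and 231 decreases up to the position \<open>p\<close> of its value 1 and
  increases afterwards; avoiding 312 puts all values to the left of \<open>p\<close> below those to the right.
  Hence it is the reversal \<open>r\<^sub>p\<close> of the first \<open>p\<close> letters of the identity. These \<open>n\<close> permutations
  are involutions, and \<open>r\<^sub>k \<circ> r\<^sub>j\<close> is again one of them only if \<open>j = k\<close>, \<open>j = 1\<close> or \<open>k = 1\<close>,
  which leaves \<open>3n - 2\<close> pairs.\<close>

text \<open>Being the identity outside \<open>{1..k}\<close>, also at 0, it permutes
  \<open>{1..n}\<close> for every \<open>n\<close> \<ge> \<open>k\<close>. Both \<open>k = 0\<close>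
  and \<open>k = 1\<close> give the identity, so indices are counted from 1.\<close>

definition rev_prefix :: "nat \<Rightarrow> nat \<Rightarrow> nat" where
  "rev_prefix k i = (if 1 \<le> i \<and> i \<le> k then k + 1 - i else i)"

lemma contains_pattern_3:
  "contains_pattern n t [x, y, z] \<longleftrightarrow>
     (\<exists>a b c. 1 \<le> a \<and> a < b \<and> b < c \<and> c \<le> n \<and> order_isomorphic [t a, t b, t c] [x, y, z])"
  (is "?L \<longleftrightarrow> ?R")
proof
  assume ?L
  then obtain cs where cs: "sorted_wrt (<) cs" "set cs \<subseteq> {1..n}"
      "order_isomorphic (map t cs) [x, y, z]"
    by (auto simp: contains_pattern_def)
  then have "length cs = Suc (Suc (Suc 0))"
    by (simp add: order_isomorphic_def)
  then obtain a b c where "cs = [a, b, c]"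
    by (auto simp: length_Suc_conv)
  with cs show ?R by auto
next
  assume ?R
  then obtain a b c where "1 \<le> a" "a < b" "b < c" "c \<le> n"
    "order_isomorphic [t a, t b, t c] [x, y, z]" by blast
  then show ?L
    unfolding contains_pattern_def by (intro exI[of _ "[a, b, c]"]) auto
qed

lemma order_isomorphic_3:
  "order_isomorphic [u, v, w] [x, y, z] \<longleftrightarrow>
     (u < v \<longleftrightarrow> x < y) \<and> (v < u \<longleftrightarrow> y < x) \<and> (u < w \<longleftrightarrow> x < z) \<and> (w < u \<longleftrightarrow> z < x) \<and>
     (v < w \<longleftrightarrow> y < z) \<and> (w < v \<longleftrightarrow> z < y)"
  by (auto simp: order_isomorphic_def less_Suc_eq numeral_3_eq_3)

lemma avoids_132:
  "avoids_pattern n t [1, 3, 2] \<longleftrightarrow>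
     \<not> (\<exists>a b c. 1 \<le> a \<and> a < b \<and> b < c \<and> c \<le> n \<and> t a < t c \<and> t c < t b)"
proof -
  have "order_isomorphic [u, v, w] [1, 3, 2] \<longleftrightarrow> u < w \<and> w < v" for u v w
    unfolding order_isomorphic_3 by auto
  then show ?thesis
    unfolding avoids_pattern_def contains_pattern_3 by simp
qed

lemma avoids_231:
  "avoids_pattern n t [2, 3, 1] \<longleftrightarrow>
     \<not> (\<exists>a b c. 1 \<le> a \<and> a < b \<and> b < c \<and> c \<le> n \<and> t c < t a \<and> t a < t b)"
proof -
  have "order_isomorphic [u, v, w] [2, 3, 1] \<longleftrightarrow> w < u \<and> u < v" for u v w
    unfolding order_isomorphic_3 by auto
  then show ?thesis
    unfolding avoids_pattern_def contains_pattern_3 by simp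
qed

lemma avoids_312:
  "avoids_pattern n t [3, 1, 2] \<longleftrightarrow>
     \<not> (\<exists>a b c. 1 \<le> a \<and> a < b \<and> b < c \<and> c \<le> n \<and> t b < t c \<and> t c < t a)"
proof -
  have "order_isomorphic [u, v, w] [3, 1, 2] \<longleftrightarrow> v < w \<and> w < u" for u v w
    unfolding order_isomorphic_3 by auto
  then show ?thesis
    unfolding avoids_pattern_def contains_pattern_3 by simp
qed

lemma rev_prefix_involution: "rev_prefix k (rev_prefix k i) = i"
  by (auto simp: rev_prefix_def)

lemma rev_prefix_1: "rev_prefix 1 = id"
  by (auto simp: rev_prefix_def fun_eq_iff)

lemma inv_rev_prefix: "inv (rev_prefix k) = rev_prefix k"
  by (rule inv_equality) (simp_all add: rev_prefix_involution)

lemma rev_prefix_permutes: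
  assumes "k \<le> n"
  shows "rev_prefix k permutes {1..n}"
proof (rule bij_imp_permutes)
  show "bij_betw (rev_prefix k) {1..n} {1..n}"
    by (rule bij_betwI[where g = "rev_prefix k"])
      (use assms in \<open>auto simp: rev_prefix_involution, auto simp: rev_prefix_def\<close>)
  show "rev_prefix k i = i" if "i \<notin> {1..n}" for i
    using that assms by (auto simp: rev_prefix_def)
qed

text \<open>For a positive index, the index is the image of 1.\<close>

lemma rev_prefix_inj:
  assumes "rev_prefix j = rev_prefix k" "1 \<le> j" "1 \<le> k"
  shows "j = k"
  using fun_cong[OF assms(1), of 1] assms(2,3) by (simp add: rev_prefix_def)

text \<open>In 132 and 231 the middle entry is the largest, but a sequence that falls and then rises
  has no such triple. In 312 the last entry lies below the first, which forces all three positions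
  into the reversed prefix, where the last two cannot ascend.\<close>

lemma rev_prefix_avoids:
  "avoids_pattern n (rev_prefix k) [1, 3, 2] \<and> avoids_pattern n (rev_prefix k) [2, 3, 1] \<and>
   avoids_pattern n (rev_prefix k) [3, 1, 2]"
  unfolding avoids_132 avoids_231 avoids_312
  by (auto simp: rev_prefix_def split: if_splits)

text \<open>Since \<open>t\<close> maps onto \<open>{1..n}\<close>, the values up to
  \<open>t i\<close> fill \<open>{1..t i}\<close>: a value is its own rank.\<close>

lemma permutes_eq_card:
  assumes t: "t permutes {1..n::nat}" and i: "i \<in> {1..n}"
  shows "t i = card {j \<in> {1..n}. t j \<le> t i}"
proof -
  have "t ` {j \<in> {1..n}. t j \<le> t i} = {x \<in> t ` {1..n}. x \<le> t i}" by auto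
  also have "\<dots> = {1..t i}"
    using permutes_in_image[OF t, of i] i unfolding permutes_image[OF t] by auto
  finally have "card (t ` {j \<in> {1..n}. t j \<le> t i}) = t i" by simp
  then show ?thesis
    by (simp add: card_image permutes_inj_on[OF t])
qed

text \<open>Ranks depend only on comparisons, so a permutation can be identified without computing
  its values.\<close>

lemma permutes_eq_of_order_eq:
  assumes t: "t permutes {1..n::nat}" and u: "u permutes {1..n}"
    and le: "\<And>i j. i \<in> {1..n} \<Longrightarrow> j \<in> {1..n} \<Longrightarrow> t i < t j \<longleftrightarrow> u i < u j"
  shows "t = u"
proof
  fix i
  show "t i = u i"
  proof (cases "i \<in> {1..n}")
    case True
    then have "{j \<in> {1..n}. t j \<le> t i} = {j \<in> {1..n}. u j \<le> u i}"
      using le by (auto simp: not_less[symmetric])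
    then show ?thesis
      using permutes_eq_card[OF t True] permutes_eq_card[OF u True] by simp
  next
    case False
    then show ?thesis
      using t u by (simp add: permutes_not_in)
  qed
qed

lemma avoiding_imp_rev_prefix:
  assumes t: "t permutes {1..n}" and n: "1 \<le> n"
    and av: "avoids_pattern n t [1, 3, 2]" "avoids_pattern n t [2, 3, 1]"
      "avoids_pattern n t [3, 1, 2]"
  shows "\<exists>k \<in> {1..n}. t = rev_prefix k"
proof -
  obtain p where p: "p \<in> {1..n}" "t p = 1"
    using permutes_image[OF t] n by (metis atLeastAtMost_iff imageE order_refl)
  have inj: "t i \<noteq> t j" if "i \<noteq> j" for i j
    using permutes_inj[OF t] that by (auto dest: injD)
  have gt1: "t p < t i" if "i \<in> {1..n}" "i \<noteq> p" for i
    using permutes_in_image[OF t, of i] that inj[of i p] p by auto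
  have dec: "t j < t i" if "1 \<le> i" "i < j" "j \<le> p" for i j
  proof (cases "j = p")
    case True
    then show ?thesis using gt1[of i] that p by auto
  next
    case False
    \<comment> \<open>An ascent from \<open>i\<close> to \<open>j\<close> before \<open>p\<close>
      would form 231 with the 1 at \<open>p\<close>.\<close>
    then have "\<not> t i < t j"
      using av(2) gt1[of i] that p unfolding avoids_231 by fastforce
    then show ?thesis using inj[of i j] that by auto
  qed
  have inc: "t i < t j" if "p < j" "i < j" "1 \<le> i" "j \<le> n" for i j
  proof -
    \<comment> \<open>A descent from \<open>i\<close> to \<open>j\<close> would form 312 with the 1
      between them, or 132 with the 1 in front; for \<open>i = p\<close> it contradicts minimality
      of 1.\<close>
    consider "i < p" | "i = p" | "p < i" by linarith
    then have "\<not> t j < t i"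
    proof cases
      case 1
      then show ?thesis using av(3) gt1[of j] that p unfolding avoids_312 by fastforce
    next
      case 2
      then show ?thesis using gt1[of j] that by auto
    next
      case 3
      then show ?thesis using av(1) gt1[of j] that p unfolding avoids_132 by fastforce
    qed
    then show ?thesis using inj[of i j] that by auto
  qed
  have lt: "t i < t j \<longleftrightarrow> rev_prefix p i < rev_prefix p j" "t j < t i \<longleftrightarrow> rev_prefix p j < rev_prefix p i"
    if "i \<in> {1..n}" "j \<in> {1..n}" "i < j" for i j
  proof -
    \<comment> \<open>For \<open>i < j\<close>, the same test on \<open>j\<close> alone decides the
      comparison for both permutations.\<close>
    have "if j \<le> p then t j < t i \<and> rev_prefix p j < rev_prefix p i
      else t i < t j \<and> rev_prefix p i < rev_prefix p j"
      using dec[of i j] inc[of j i] that by (auto simp: rev_prefix_def)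
    then show "t i < t j \<longleftrightarrow> rev_prefix p i < rev_prefix p j"
      "t j < t i \<longleftrightarrow> rev_prefix p j < rev_prefix p i"
      by (auto split: if_splits)
  qed
  have "t = rev_prefix p"
  proof (rule permutes_eq_of_order_eq[OF t])
    show "rev_prefix p permutes {1..n}"
      using p by (intro rev_prefix_permutes) auto
    show "t i < t j \<longleftrightarrow> rev_prefix p i < rev_prefix p j" if "i \<in> {1..n}" "j \<in> {1..n}" for i j
      using lt[of i j] lt[of j i] that by (cases i j rule: linorder_cases) auto
  qed
  with p show ?thesis by blast
qed

lemma avoiding_iff_rev_prefix:
  assumes "t permutes {1..n}" "1 \<le> n"
  shows "(\<forall>p \<in> {[1, 3, 2], [2, 3, 1], [3, 1, 2]}. avoids_pattern n t p) \<longleftrightarrow>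
    (\<exists>k \<in> {1..n}. t = rev_prefix k)"
  using avoiding_imp_rev_prefix[OF assms] rev_prefix_avoids by auto

lemma rev_prefix_comp_iff:
  assumes "j \<in> {1..n}" "k \<in> {1..n}"
  shows "(\<exists>m \<in> {1..n}. rev_prefix k \<circ> rev_prefix j = rev_prefix m) \<longleftrightarrow> j = k \<or> j = 1 \<or> k = 1"
    (is "?L \<longleftrightarrow> ?R")
proof
  assume ?R
  then consider "j = k" | "j = 1" | "k = 1" by blast
  then show ?L
  proof cases
    case 1
    then have "rev_prefix k \<circ> rev_prefix j = rev_prefix 1"
      unfolding rev_prefix_1 by (simp add: fun_eq_iff rev_prefix_involution)
    with assms show ?thesis by (intro bexI[of _ 1]) auto
  qed (use assms in \<open>auto simp: rev_prefix_1[simplified]\<close>)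
next
  assume ?L
  then obtain m where m: "1 \<le> m" "\<And>i. rev_prefix k (rev_prefix j i) = rev_prefix m i"
    by (auto simp: fun_eq_iff)
  show ?R
  proof (rule ccontr)
    assume "\<not> ?R"
    then have jk: "j \<noteq> k" "2 \<le> j" "2 \<le> k" using assms by auto
    show False
    proof (cases "j < k")
      case True
      \<comment> \<open>Here 1 goes to \<open>j\<close> and then to \<open>k + 1 - j\<close>, so
        \<open>m = k + 1 - j\<close>, which is at least 2. But 2 goes to \<open>j - 1\<close> and
        then to \<open>m + 1\<close>, whereas \<open>rev_prefix m\<close> sends 2 to
        \<open>m - 1\<close>.\<close>
      then show False
        using m(1) m(2)[of 1] m(2)[of 2] jk by (auto simp: rev_prefix_def split: if_splits)
    next
      case False
      \<comment> \<open>Now \<open>k < j\<close>, so 1 goes to \<open>j\<close> and stays there,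
        giving \<open>m = j\<close>. Then \<open>j\<close> should go to 1, but it goes to 1 and then
        to \<open>k\<close>, which exceeds 1.\<close>
      then show False
        using m(1) m(2)[of 1] m(2)[of j] jk by (simp add: rev_prefix_def split: if_splits)
    qed
  qed
qed

lemma avoiding_three_perms_eq:
  assumes "1 \<le> n"
  shows "avoiding_three_perms n {[1, 3, 2], [2, 3, 1], [3, 1, 2]} =
    (\<lambda>(j, k). (rev_prefix j, rev_prefix k)) `
      {(j, k) \<in> {1..n} \<times> {1..n}. j = k \<or> j = 1 \<or> k = 1}"
    (is "avoiding_three_perms n ?P = ?f ` ?I")
proof (rule set_eqI, clarify)
  fix s s'
  have "(s, s') \<in> avoiding_three_perms n ?P \<longleftrightarrow>
      s permutes {1..n} \<and> s' permutes {1..n} \<and> (\<forall>p \<in> ?P. avoids_pattern n s p) \<and>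
      (\<forall>p \<in> ?P. avoids_pattern n s' p) \<and> (\<forall>p \<in> ?P. avoids_pattern n (s' \<circ> inv s) p)"
    by (auto simp: avoiding_three_perms_def three_perms_def three_perm_avoids_def)
  also have "\<dots> \<longleftrightarrow> s permutes {1..n} \<and> s' permutes {1..n} \<and>
      (\<exists>j \<in> {1..n}. s = rev_prefix j) \<and> (\<exists>k \<in> {1..n}. s' = rev_prefix k) \<and>
      (\<exists>m \<in> {1..n}. s' \<circ> inv s = rev_prefix m)"
    by (intro conj_cong refl avoiding_iff_rev_prefix[OF _ assms] permutes_compose permutes_inv)
  \<comment> \<open>Each reversal is its own inverse, so the third permutation becomes a composition
    of two reversals.\<close>
  also have "\<dots> \<longleftrightarrow> (\<exists>j \<in> {1..n}. \<exists>k \<in> {1..n}. s = rev_prefix j \<and> s' = rev_prefix k \<and>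
      (\<exists>m \<in> {1..n}. rev_prefix k \<circ> rev_prefix j = rev_prefix m))"
    using rev_prefix_permutes[of _ n] by (metis atLeastAtMost_iff inv_rev_prefix)
  also have "\<dots> \<longleftrightarrow> (\<exists>j \<in> {1..n}. \<exists>k \<in> {1..n}. s = rev_prefix j \<and> s' = rev_prefix k \<and>
      (j = k \<or> j = 1 \<or> k = 1))"
    using rev_prefix_comp_iff by meson
  also have "\<dots> \<longleftrightarrow> (s, s') \<in> ?f ` ?I"
    unfolding image_iff by (simp add: Bex_def) blast
  finally show "(s, s') \<in> avoiding_three_perms n ?P \<longleftrightarrow> (s, s') \<in> ?f ` ?I" .
qed

lemma card_avoiding_three_perms:
  assumes "1 \<le> n"
  shows "card (avoiding_three_perms n {[1, 3, 2], [2, 3, 1], [3, 1, 2]}) = 3 * n - 2"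
proof -
  let ?I = "{(j, k) \<in> {1..n} \<times> {1..n}. j = k \<or> j = 1 \<or> k = 1}"
  \<comment> \<open>The diagonal takes \<open>(1, 1)\<close>; the two arms start at 2 to stay
    disjoint from it and from each other. The count is \<open>n + 2 * (n - 1)\<close>.\<close>
  let ?D = "(\<lambda>k. (k, k)) ` {1..n}" and ?A = "{1} \<times> {2..n}" and ?B = "{2..n} \<times> {1}"
  have "inj_on (\<lambda>(j, k). (rev_prefix j, rev_prefix k)) ?I"
    by (auto simp: inj_on_def dest: rev_prefix_inj)
  then have "card (avoiding_three_perms n {[1, 3, 2], [2, 3, 1], [3, 1, 2]}) = card ?I"
    unfolding avoiding_three_perms_eq[OF assms] by (rule card_image)
  also have "\<dots> = card (?D \<union> (?A \<union> ?B))"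
    using assms by (intro arg_cong[of _ _ card]) auto
  also have "\<dots> = card ?D + (card ?A + card ?B)"
    by (subst card_Un_disjoint; (subst card_Un_disjoint)?; auto)
  also have "card ?D = n"
    by (simp add: card_image inj_on_def)
  also have "n + (card ?A + card ?B) = 3 * n - 2"
    using assms by (simp add: card_cartesian_product)
  finally show ?thesis .
qed

theorem theorem4p3:
  fixes a :: "nat \<Rightarrow> nat"
  assumes a_def: "\<And>n. n \<ge> 1 \<Longrightarrow>
    a n = card (avoiding_three_perms n {[1, 3, 2], [2, 3, 1], [3, 1, 2]})"
  shows "a 1 = 1 \<and> (\<forall>n \<ge> 1. a (n + 1) = a n + 3)"
proof -
  \<comment> \<open>With \<open>n\<close> \<ge> 1 the natural subtraction does not truncate, so the
    formula grows by 3 at each step.\<close>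
  have "a n = 3 * n - 2" if "n \<ge> 1" for n
    using a_def[OF that] card_avoiding_three_perms[OF that] by simp
  then show ?thesis by auto
qed

end
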